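(* Let $n\ge 3$ be a fixed natural number. Let $x\ge x_0>0$ with $x_0$ a suitable constant, let $y$ satisfy $\ln x<y\le x(\ln x)^{-1}$, and let $\alpha$ be a real number such that $$\left|\alpha-\frac aq\right|\le\frac1{q^2},\qquad (a,q)=1,$$ for some integer $a$ and natural number $q$. Then $$|T(\alpha;x,y)|\ll y\left(\frac1q+\frac1y+\frac{q}{y^n}\right)^{2^{-n}}(\ln qy)^{(n-1)^2 2^{-n}},$$ where the implied constant depends only on $n$.
   Context: $T(\alpha;x,y)=\sum_{x-y<m\le x}e(\alpha m^n)$, the sum over integers $m$, where $e(t)=e^{2\pi i t}$. The notation $A\ll B$ means $|A|\le CB$ for some constant $C$. *)

theory Defs
  imports Complex_Main
begin

definition e_exp :: "real \<Rightarrow> complex" where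
  "e_exp t = exp (2 * of_real pi * \<i> * of_real t)"

definition T :: "nat \<Rightarrow> real \<Rightarrow> real \<Rightarrow> real \<Rightarrow> complex" where
  "T n \<alpha> x y = (\<Sum>m | x - y < of_int m \<and> of_int m \<le> x. e_exp (\<alpha> * of_int (m :: int) ^ n))"

end

theory Submission imports Defs "HOL-Analysis.Analysis"
begin

text \<open>
  Weyl differencing \<open>n - 1\<close> times, with \<open>k = n - 1\<close>, bounds the \<open>2 ^ k\<close>-th power of the sum by an average of
  \<open>min N (1 / \<bar>sin (pi * \<alpha> * n! * h\<^sub>1 * \<dots> * h\<^sub>k)\<bar>)\<close> over \<open>\<bar>h\<^sub>i\<bar> < N\<close>. By Cauchy-Schwarz the square of the
  part with all \<open>h\<^sub>i > 0\<close> is at most the number of solutions of \<open>h\<^sub>1 \<dots> h\<^sub>k = h\<^sub>1' \<dots> h\<^sub>k'\<close> with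
  \<open>1 \<le> h\<^sub>i, h\<^sub>i' \<le> N\<close>, times the sum of the squared minima over all \<open>t \<le> N ^ k\<close>. Since the \<open>k\<close>-fold divisor
  function \<open>\<tau>\<^sub>k\<close> is submultiplicative, the number of solutions is at most
  \<open>(\<Sum>h\<le>N. \<tau>\<^sub>k h) ^ k \<le> (N * (1 + ln N) ^ (k - 1)) ^ k\<close>. The sum of minima is treated by cutting into
  blocks of length \<open>q\<close>, on which \<open>a * t\<close> runs through all residues modulo \<open>q\<close>. Altogether the logarithm
  occurs with exponent \<open>k * (k - 1) + 1 \<le> (n - 1)\<^sup>2\<close>.
\<close>

section \<open>Weyl differencing\<close>

lemma e_exp_eq_cis: "e_exp t = cis (2 * pi * t)"
  by (simp add: e_exp_def cis_conv_exp mult_ac)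

lemma norm_e_exp [simp]: "norm (e_exp t) = 1"
  by (simp add: e_exp_eq_cis)

lemma e_exp_add: "e_exp (s + t) = e_exp s * e_exp t"
  by (simp add: e_exp_eq_cis cis_mult ring_distribs)

lemma e_exp_diff: "e_exp (s - t) = e_exp s * cnj (e_exp t)"
  by (simp add: e_exp_eq_cis cis_mult cis_cnj ring_distribs)

lemma e_exp_power: "e_exp t ^ k = e_exp (t * real k)"
proof (induction k)
  case (Suc k)
  then show ?case
    using e_exp_add[of t "t * real k"] by (simp add: algebra_simps)
qed (simp add: e_exp_def)

lemma norm_one_minus_e_exp: "norm (1 - e_exp t) = 2 * \<bar>sin (pi * t)\<bar>"
proof -
  have "(norm (1 - e_exp t))\<^sup>2 = (1 - cos (2 * (pi * t)))\<^sup>2 + (sin (2 * (pi * t)))\<^sup>2"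
    by (simp add: e_exp_eq_cis cmod_power2 mult_ac)
  also have "\<dots> = 2 - 2 * cos (2 * (pi * t))"
    using sin_cos_squared_add[of "2 * (pi * t)"] by (simp add: power2_eq_square algebra_simps)
  also have "\<dots> = (2 * \<bar>sin (pi * t)\<bar>)\<^sup>2"
    by (simp add: cos_double_sin power_mult_distrib)
  finally show ?thesis
    by (metis abs_ge_zero mult_nonneg_nonneg norm_ge_zero power2_eq_imp_eq zero_le_numeral)
qed

text \<open>This is \<open>min N (1 / \<bar>sin (pi * t)\<bar>)\<close>, with value \<open>N\<close> at the integers.\<close>

definition linear_bound :: "nat \<Rightarrow> real \<Rightarrow> real" where
  "linear_bound N t = real N / max 1 (real N * \<bar>sin (pi * t)\<bar>)"

lemma linear_bound_nonneg: "0 \<le> linear_bound N t"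
  by (simp add: linear_bound_def)

lemma linear_bound_le: "linear_bound N t \<le> real N"
  unfolding linear_bound_def by (subst pos_divide_le_eq) (auto simp: mult_le_cancel_left1)

lemma linear_bound_minus [simp]: "linear_bound N (- t) = linear_bound N t"
  by (simp add: linear_bound_def)

lemma linear_bound_add_int: "linear_bound N (t + of_int k) = linear_bound N t"
proof -
  have "sin (pi * (t + of_int k)) = sin (pi * t) * cos (pi * of_int k)"
    by (simp add: ring_distribs sin_add)
  moreover have "\<bar>cos (pi * of_int k)\<bar> = 1"
    by simp
  ultimately show ?thesis
    by (simp add: linear_bound_def abs_mult)
qed

lemma linear_bound_le_inverse:
  assumes "0 < \<delta>" "\<delta> \<le> \<bar>sin (pi * t)\<bar>"
  shows "linear_bound N t \<le> 1 / \<delta>"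
proof -
  have "real N * \<delta> \<le> max 1 (real N * \<bar>sin (pi * t)\<bar>)"
    using assms by (meson max.coboundedI2 mult_left_mono of_nat_0_le_iff)
  then show ?thesis
    using assms by (simp add: linear_bound_def field_simps)
qed

text \<open>A geometric series: multiplying by \<open>1 - e_exp t\<close>, of norm
  \<open>2 * \<bar>sin (pi * t)\<bar>\<close>, leaves a norm of at most 2. The product form avoids a
  division by zero at integers \<open>t\<close>.\<close>

lemma norm_sum_linear_phase_le:
  assumes "B - A < int N"
  shows "norm (\<Sum>m\<in>{A..B}. e_exp (c + t * of_int m)) \<le> linear_bound N t"
proof -
  define M where "M = nat (B - A + 1)"
  have "norm (\<Sum>m\<in>{A..B}. e_exp (c + t * of_int m)) \<le> (\<Sum>m\<in>{A..B}. 1)"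
    by (rule order_trans[OF norm_sum]) simp
  also have "\<dots> \<le> real N"
    using assms by simp
  finally have le_N: "norm (\<Sum>m\<in>{A..B}. e_exp (c + t * of_int m)) \<le> real N" .
  have "(\<Sum>m\<in>{A..B}. e_exp (c + t * of_int m)) = (\<Sum>i<M. e_exp (c + t * of_int (A + int i)))"
    by (rule sum.reindex_bij_witness[of _ "\<lambda>i. A + int i" "\<lambda>m. nat (m - A)"])
       (auto simp: M_def)
  also have "\<dots> = e_exp (c + t * of_int A) * (\<Sum>i<M. e_exp t ^ i)"
    by (simp add: sum_distrib_left e_exp_power flip: e_exp_add) (simp add: algebra_simps)
  finally have eq: "(\<Sum>m\<in>{A..B}. e_exp (c + t * of_int m)) = e_exp (c + t * of_int A) * (\<Sum>i<M. e_exp t ^ i)" .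
  have "norm (1 - e_exp t) * norm (\<Sum>m\<in>{A..B}. e_exp (c + t * of_int m)) = norm (1 - e_exp t ^ M)"
    by (simp add: eq norm_mult one_diff_power_eq)
  also have "\<dots> \<le> 2"
    using norm_triangle_ineq4[of 1 "e_exp t ^ M"] by (simp add: norm_power)
  finally have "norm (\<Sum>m\<in>{A..B}. e_exp (c + t * of_int m)) * \<bar>sin (pi * t)\<bar> \<le> 1"
    by (simp add: norm_one_minus_e_exp mult_ac)
  from mult_left_mono[OF this, of "real N"] le_N show ?thesis
    unfolding linear_bound_def by (subst pos_le_divide_eq) (auto simp: max_def mult_ac)
qed

section \<open>Phases with constant iterated differences\<close>

text \<open>All \<open>d\<close>-th differences of \<open>g\<close> with steps \<open>h\<^sub>1, \<dots>, h\<^sub>d\<close> equal \<open>b * h\<^sub>1 * \<dots> * h\<^sub>d\<close>, so that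
  \<open>b\<close> is \<open>d!\<close> times the coefficient of degree \<open>d\<close>.\<close>

fun has_top_difference :: "nat \<Rightarrow> real \<Rightarrow> (int \<Rightarrow> real) \<Rightarrow> bool" where
  "has_top_difference 0 b g \<longleftrightarrow> (\<forall>m. g m = b)"
| "has_top_difference (Suc d) b g \<longleftrightarrow>
     (\<forall>h. has_top_difference d (b * of_int h) (\<lambda>m. g (m + h) - g m))"

lemma has_top_difference_add:
  "has_top_difference d b g \<Longrightarrow> has_top_difference d b' g' \<Longrightarrow>
     has_top_difference d (b + b') (\<lambda>m. g m + g' m)"
proof (induction d arbitrary: b b' g g')
  case (Suc d)
  show ?case
  proof (simp, intro allI)
    fix h
    have "has_top_difference d (b * of_int h + b' * of_int h)
            (\<lambda>m. (g (m + h) - g m) + (g' (m + h) - g' m))"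
      using Suc.prems by (intro Suc.IH) simp_all
    then show "has_top_difference d ((b + b') * of_int h) (\<lambda>m. g (m + h) + g' (m + h) - (g m + g' m))"
      by (simp add: algebra_simps)
  qed
qed simp

lemma has_top_difference_cmult:
  "has_top_difference d b g \<Longrightarrow> has_top_difference d (c * b) (\<lambda>m. c * g m)"
proof (induction d arbitrary: b g)
  case (Suc d)
  show ?case
  proof (simp, intro allI)
    fix h
    have "has_top_difference d (c * (b * of_int h)) (\<lambda>m. c * (g (m + h) - g m))"
      using Suc.prems by (intro Suc.IH) simp
    then show "has_top_difference d (c * b * of_int h) (\<lambda>m. c * g (m + h) - c * g m)"
      by (simp add: algebra_simps)
  qed
qed simp

lemma has_top_difference_zero: "has_top_difference d 0 (\<lambda>_. 0)"
  by (induction d) simp_all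

lemma has_top_difference_sum:
  "(\<And>i. i \<in> I \<Longrightarrow> has_top_difference d (b i) (g i)) \<Longrightarrow>
     has_top_difference d (\<Sum>i\<in>I. b i) (\<lambda>m. \<Sum>i\<in>I. g i m)"
  by (induction I rule: infinite_finite_induct)
     (simp_all add: has_top_difference_zero has_top_difference_add)

text \<open>By the binomial theorem, differencing \<open>m ^ j\<close> leaves degrees below
  \<open>j\<close>, with leading coefficient \<open>j * h\<close>. Exponents \<open>j < d\<close>
  are included because the induction meets all these lower terms.\<close>

lemma has_top_difference_power:
  "j \<le> d \<Longrightarrow> has_top_difference d (if j = d then fact d else 0) (\<lambda>m. of_int m ^ j)"
proof (induction d arbitrary: j)
  case (Suc d)
  show ?case
  proof (simp only: has_top_difference.simps, intro allI)
    fix h :: int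
    define c where "c i = real (j choose i) * of_int h ^ (j - i)" for i
    have "has_top_difference d (\<Sum>i<j. c i * (if i = d then fact d else 0)) (\<lambda>m. \<Sum>i<j. c i * of_int m ^ i)"
      using Suc.prems by (intro has_top_difference_sum has_top_difference_cmult Suc.IH) auto
    moreover have "(\<lambda>m. \<Sum>i<j. c i * of_int m ^ i) = (\<lambda>m. of_int (m + h) ^ j - of_int m ^ j)"
    proof
      fix m :: int
      have "(of_int (m + h) :: real) ^ j = (\<Sum>i\<le>j. c i * of_int m ^ i)"
        by (simp add: binomial_ring c_def mult_ac)
      also have "\<dots> = (\<Sum>i<j. c i * of_int m ^ i) + of_int m ^ j"
        by (simp add: lessThan_Suc c_def flip: lessThan_Suc_atMost)
      finally show "(\<Sum>i<j. c i * of_int m ^ i) = of_int (m + h) ^ j - (of_int m :: real) ^ j"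
        by simp
    qed
    moreover have "(\<Sum>i<j. c i * (if i = d then fact d else 0)) = (if j = Suc d then fact (Suc d) else 0) * of_int h"
    proof -
      have "(\<Sum>i<j. c i * (if i = d then fact d else 0)) = (\<Sum>i<j. if i = d then c d * fact d else 0)"
        by (intro sum.cong) auto
      also have "\<dots> = (if j = Suc d then fact (Suc d) else 0) * of_int h"
        using Suc.prems by (cases "j = Suc d") (auto simp: c_def)
      finally show ?thesis .
    qed
    ultimately show "has_top_difference d ((if j = Suc d then fact (Suc d) else 0) * of_int h)
            (\<lambda>m. of_int (m + h) ^ j - of_int m ^ j)"
      by simp
  qed
qed simp

text \<open>Expand the square as a double sum over \<open>m\<close> and \<open>m'\<close> and put
  \<open>m' = m + h\<close>; for fixed \<open>h\<close> the admissible \<open>m\<close> again form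
  an interval.\<close>

lemma norm_sum_e_exp_squared_le:
  assumes "B - A < int N"
  shows "(norm (\<Sum>m\<in>{A..B}. e_exp (g m)))\<^sup>2
           \<le> (\<Sum>h\<in>{- int N<..<int N}. norm (\<Sum>m\<in>{max A (A - h)..min B (B - h)}. e_exp (g (m + h) - g m)))"
proof -
  let ?H = "{- int N<..<int N}"
  have "complex_of_real ((norm (\<Sum>m\<in>{A..B}. e_exp (g m)))\<^sup>2)
          = (\<Sum>m\<in>{A..B}. \<Sum>m'\<in>{A..B}. e_exp (g m' - g m))"
    by (subst complex_norm_square, subst sum.swap) (simp add: sum_product e_exp_diff)
  also have "\<dots> = (\<Sum>m\<in>{A..B}. \<Sum>h\<in>?H. if m + h \<in> {A..B} then e_exp (g (m + h) - g m) else 0)"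
  proof (rule sum.cong[OF refl])
    fix m assume "m \<in> {A..B}"
    then have "(\<Sum>m'\<in>{A..B}. e_exp (g m' - g m)) = (\<Sum>h\<in>{h \<in> ?H. m + h \<in> {A..B}}. e_exp (g (m + h) - g m))"
      using assms
      by (intro sum.reindex_bij_witness[of _ "\<lambda>h. m + h" "\<lambda>m'. m' - m"]) auto
    then show "(\<Sum>m'\<in>{A..B}. e_exp (g m' - g m))
                 = (\<Sum>h\<in>?H. if m + h \<in> {A..B} then e_exp (g (m + h) - g m) else 0)"
      by (subst sum.inter_filter[symmetric]) auto
  qed
  also have "\<dots> = (\<Sum>h\<in>?H. \<Sum>m\<in>{A..B}. if m + h \<in> {A..B} then e_exp (g (m + h) - g m) else 0)"
    by (rule sum.swap)
  also have "\<dots> = (\<Sum>h\<in>?H. \<Sum>m\<in>{max A (A - h)..min B (B - h)}. e_exp (g (m + h) - g m))"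
    by (rule sum.cong[OF refl], subst sum.inter_filter[symmetric]) (auto intro!: sum.cong)
  finally have "(norm (\<Sum>m\<in>{A..B}. e_exp (g m)))\<^sup>2
      = norm (\<Sum>h\<in>?H. \<Sum>m\<in>{max A (A - h)..min B (B - h)}. e_exp (g (m + h) - g m))"
    by (metis abs_of_nonneg norm_of_real zero_le_power2)
  also have "\<dots> \<le> (\<Sum>h\<in>?H. norm (\<Sum>m\<in>{max A (A - h)..min B (B - h)}. e_exp (g (m + h) - g m)))"
    by (rule norm_sum)
  finally show ?thesis .
qed

text \<open>The power mean inequality for exponents \<open>2 ^ k\<close>, by repeated
  Cauchy-Schwarz.\<close>

lemma sum_power_two_power_le:
  fixes f :: "'a \<Rightarrow> real"
  assumes "\<And>i. i \<in> I \<Longrightarrow> 0 \<le> f i"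
  shows "(\<Sum>i\<in>I. f i) ^ (2 ^ k) \<le> real (card I) ^ (2 ^ k - 1) * (\<Sum>i\<in>I. f i ^ (2 ^ k))"
proof (induction k)
  case (Suc k)
  have exp: "2 ^ Suc k - 1 = (2 ^ k - 1) * 2 + (1::nat)"
    using one_le_power[of "2::nat" k] unfolding power_Suc by linarith
  have "(\<Sum>i\<in>I. f i) ^ (2 ^ Suc k) = ((\<Sum>i\<in>I. f i) ^ (2 ^ k))\<^sup>2"
    by (simp add: power_mult mult.commute flip: power_mult)
  also have "\<dots> \<le> (real (card I) ^ (2 ^ k - 1) * (\<Sum>i\<in>I. f i ^ (2 ^ k)))\<^sup>2"
    by (intro power_mono Suc.IH zero_le_power sum_nonneg assms)
  also have "\<dots> = real (card I) ^ ((2 ^ k - 1) * 2) * (\<Sum>i\<in>I. f i ^ (2 ^ k))\<^sup>2"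
    by (simp add: power_mult_distrib power_mult)
  also have "\<dots> \<le> real (card I) ^ ((2 ^ k - 1) * 2) * ((\<Sum>i\<in>I. (f i ^ (2 ^ k))\<^sup>2) * real (card I))"
    by (intro mult_left_mono sum_squared_le_sum_of_squares) simp
  also have "\<dots> = real (card I) ^ (2 ^ Suc k - 1) * (\<Sum>i\<in>I. f i ^ (2 ^ Suc k))"
    unfolding exp by (simp add: power_add mult_ac flip: power_mult)
  finally show ?case .
qed simp

text \<open>The sum of \<open>f (b * h\<^sub>1 * \<dots> * h\<^sub>k)\<close> over all \<open>\<bar>h\<^sub>i\<bar> < N\<close>.\<close>

fun weyl_sum :: "nat \<Rightarrow> nat \<Rightarrow> (real \<Rightarrow> real) \<Rightarrow> real \<Rightarrow> real" where
  "weyl_sum N 0 f b = f b"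
| "weyl_sum N (Suc k) f b = (\<Sum>h\<in>{- int N<..<int N}. weyl_sum N k f (b * of_int h))"

lemma Suc_le_two_power: "Suc k \<le> 2 ^ k"
  by (induction k) auto

text \<open>Each squaring lowers the degree of the phase by one, until a geometric series remains.
  Differencing never lengthens the interval, so one \<open>N\<close> serves throughout the
  induction.\<close>

lemma weyl_differencing:
  assumes "has_top_difference (Suc k) b g" "B - A < int N"
  shows "norm (\<Sum>m\<in>{A..B}. e_exp (g m)) ^ (2 ^ k)
           \<le> (2 * real N) ^ (2 ^ k - Suc k) * weyl_sum N k (linear_bound N) b"
  using assms
proof (induction k arbitrary: b g A B)
  case 0
  then have "\<forall>h m. g (m + h) - g m = b * of_int h"
    by simp
  then have "g (0 + m) - g 0 = b * of_int m" for m
    by blast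
  then have g: "g m = g 0 + b * of_int m" for m
    by (metis add_0 diff_eq_eq add.commute)
  then have "(\<Sum>m\<in>{A..B}. e_exp (g m)) = (\<Sum>m\<in>{A..B}. e_exp (g 0 + b * of_int m))"
    by (intro sum.cong refl arg_cong[of _ _ e_exp]) (rule g)
  then show ?case
    using norm_sum_linear_phase_le[OF 0(2)] by simp
next
  case (Suc k)
  let ?H = "{- int N<..<int N}"
  let ?S = "\<lambda>h. norm (\<Sum>m\<in>{max A (A - h)..min B (B - h)}. e_exp (g (m + h) - g m))"
  let ?V = "\<lambda>h. weyl_sum N k (linear_bound N) (b * of_int h)"
  have card: "real (card ?H) \<le> 2 * real N"
    by auto
  \<comment> \<open>The power mean inequality contributes \<open>2 ^ k - 1\<close> factors
    \<open>2 * N\<close> and the induction hypothesis \<open>2 ^ k - Suc k\<close>; no subtraction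
    is truncated.\<close>
  have exp: "2 ^ Suc k - Suc (Suc k) = (2 ^ k - 1) + (2 ^ k - Suc k)"
    using Suc_le_two_power[of k] by simp
  have "norm (\<Sum>m\<in>{A..B}. e_exp (g m)) ^ (2 ^ Suc k) = ((norm (\<Sum>m\<in>{A..B}. e_exp (g m)))\<^sup>2) ^ (2 ^ k)"
    by (simp add: power_mult)
  also have "\<dots> \<le> (\<Sum>h\<in>?H. ?S h) ^ (2 ^ k)"
    by (intro power_mono norm_sum_e_exp_squared_le Suc.prems) simp
  also have "\<dots> \<le> real (card ?H) ^ (2 ^ k - 1) * (\<Sum>h\<in>?H. ?S h ^ (2 ^ k))"
    by (rule sum_power_two_power_le) simp
  also have "\<dots> \<le> (2 * real N) ^ (2 ^ k - 1) * (\<Sum>h\<in>?H. ?S h ^ (2 ^ k))"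
    by (intro mult_right_mono power_mono card sum_nonneg) simp_all
  also have "\<dots> \<le> (2 * real N) ^ (2 ^ k - 1) * (\<Sum>h\<in>?H. (2 * real N) ^ (2 ^ k - Suc k) * ?V h)"
    using Suc.prems by (intro mult_left_mono sum_mono Suc.IH) auto
  also have "\<dots> = (2 * real N) ^ (2 ^ Suc k - Suc (Suc k)) * weyl_sum N (Suc k) (linear_bound N) b"
    unfolding exp power_add by (simp only: weyl_sum.simps mult.assoc sum_distrib_left[symmetric])
  finally show ?case .
qed

section \<open>Reduction to positive steps\<close>

lemma weyl_sum_nonneg: "(\<And>t. 0 \<le> f t) \<Longrightarrow> 0 \<le> weyl_sum N k f b"
  by (induction k arbitrary: b) (simp_all add: sum_nonneg)

lemma weyl_sum_minus: "(\<And>t. f (- t) = f t) \<Longrightarrow> weyl_sum N k f (- b) = weyl_sum N k f b"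
proof (induction k arbitrary: b)
  case (Suc k)
  then show ?case
    by (metis (mono_tags, lifting) mult_minus_left sum.cong weyl_sum.simps(2))
qed simp

text \<open>Trivial bound for what remains once a step \<open>h = 0\<close> has been chosen.\<close>

lemma weyl_sum_zero_le:
  assumes "\<And>t. 0 \<le> f t" "f 0 \<le> real N"
  shows "weyl_sum N k f 0 \<le> (2 * real N) ^ k * real N"
proof (induction k)
  case (Suc k)
  have "weyl_sum N (Suc k) f 0 = real (card {- int N<..<int N}) * weyl_sum N k f 0"
    by simp
  also have "\<dots> \<le> (2 * real N) * ((2 * real N) ^ k * real N)"
    using Suc.IH by (intro mult_mono weyl_sum_nonneg assms) auto
  finally show ?case by (simp add: mult_ac)
qed (use assms in simp)

text \<open>The sum of \<open>F (r * h\<^sub>1 * \<dots> * h\<^sub>k)\<close> over all \<open>1 \<le> h\<^sub>i \<le> N\<close>.\<close>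

fun box_sum :: "nat \<Rightarrow> nat \<Rightarrow> (nat \<Rightarrow> real) \<Rightarrow> nat \<Rightarrow> real" where
  "box_sum N 0 F r = F r"
| "box_sum N (Suc k) F r = (\<Sum>h\<in>{1..N}. box_sum N k F (r * h))"

lemma sum_symmetric_interval_le:
  fixes v :: "int \<Rightarrow> real"
  assumes "\<And>h. v (- h) = v h" "\<And>h. 0 \<le> v h"
  shows "(\<Sum>h\<in>{- int N<..<int N}. v h) \<le> v 0 + 2 * (\<Sum>h\<in>{1..N}. v (int h))"
proof -
  \<comment> \<open>The larger set also contains \<open>N\<close> and \<open>- N\<close>, so that
    the range matches that of \<open>box_sum\<close>; nonnegativity allows this.\<close>
  have "(\<Sum>h\<in>{- int N<..<int N}. v h) \<le> (\<Sum>h\<in>{0} \<union> (int ` {1..N} \<union> (\<lambda>h. - int h) ` {1..N}). v h)"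
  proof (intro sum_mono2)
    show "{- int N<..<int N} \<subseteq> {0} \<union> (int ` {1..N} \<union> (\<lambda>h. - int h) ` {1..N})"
    proof
      fix h assume "h \<in> {- int N<..<int N}"
      then have "h = 0 \<or> h = int (nat h) \<and> nat h \<in> {1..N} \<or> h = - int (nat (- h)) \<and> nat (- h) \<in> {1..N}"
        by auto
      then show "h \<in> {0} \<union> (int ` {1..N} \<union> (\<lambda>h. - int h) ` {1..N})"
        by blast
    qed
  qed (use assms in auto)
  also have "\<dots> = v 0 + ((\<Sum>h\<in>int ` {1..N}. v h) + (\<Sum>h\<in>(\<lambda>h. - int h) ` {1..N}. v h))"
    by (subst sum.union_disjoint, simp, simp, force, subst sum.union_disjoint) auto
  also have "(\<Sum>h\<in>int ` {1..N}. v h) = (\<Sum>h\<in>{1..N}. v (int h))"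
    by (subst sum.reindex) auto
  also have "(\<Sum>h\<in>(\<lambda>h. - int h) ` {1..N}. v h) = (\<Sum>h\<in>{1..N}. v (int h))"
    by (subst sum.reindex) (auto simp: inj_on_def assms)
  finally show ?thesis by simp
qed

text \<open>At each level the signs of \<open>h\<close> give a factor 2 and \<open>h = 0\<close>
  goes into the error. The errors satisfy \<open>E (k + 1) = (2 * N) ^ k * N + 2 * N * E k\<close>
  with \<open>E 0 = 0\<close>, which explains their closed form.\<close>

lemma weyl_sum_le_box_sum:
  assumes f: "\<And>t. 0 \<le> f t" "\<And>t. f (- t) = f t" "f 0 \<le> real N"
  shows "weyl_sum N k f (b * real r)
           \<le> 2 ^ k * box_sum N k (\<lambda>s. f (b * real s)) r + real k * (2 * real N) ^ k / 2"
proof (induction k arbitrary: r)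
  case (Suc k)
  let ?P = "\<lambda>h. box_sum N k (\<lambda>s. f (b * real s)) (r * h)"
  let ?E = "real k * (2 * real N) ^ k / 2"
  have "weyl_sum N (Suc k) f (b * real r)
      \<le> weyl_sum N k f 0 + 2 * (\<Sum>h\<in>{1..N}. weyl_sum N k f (b * real (r * h)))"
    using sum_symmetric_interval_le[of "\<lambda>h. weyl_sum N k f (b * real r * of_int h)" N] f
    by (simp add: weyl_sum_nonneg weyl_sum_minus mult_ac)
  also have "\<dots> \<le> (2 * real N) ^ k * real N + 2 * (\<Sum>h\<in>{1..N}. 2 ^ k * ?P h + ?E)"
    by (intro add_mono weyl_sum_zero_le mult_left_mono sum_mono Suc.IH f) simp
  also have "\<dots> = 2 ^ Suc k * box_sum N (Suc k) (\<lambda>s. f (b * real s)) r + real (Suc k) * (2 * real N) ^ Suc k / 2"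
    by (simp add: sum.distrib sum_distrib_left[symmetric] algebra_simps)
  finally show ?case .
qed simp

section \<open>Divisor functions and the number of representations\<close>

text \<open>The index is shifted: \<open>divisor_fun k r\<close> is the number of factorisations of \<open>r\<close> into \<open>k + 1\<close>
  factors. For \<open>r = 0\<close> and \<open>k > 0\<close> it has the junk value \<open>0\<close>, a sum over an infinite set.\<close>

fun divisor_fun :: "nat \<Rightarrow> nat \<Rightarrow> real" where
  "divisor_fun 0 r = 1"
| "divisor_fun (Suc k) r = (\<Sum>d | d dvd r. divisor_fun k d)"

lemma divisor_fun_nonneg: "0 \<le> divisor_fun k r"
  by (induction k arbitrary: r) (simp_all add: sum_nonneg)

text \<open>Every divisor of \<open>a * b\<close> is some \<open>x * y\<close> with
  \<open>x dvd a\<close> and \<open>y dvd b\<close>; summing over all such pairs can only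
  overcount.\<close>

lemma divisor_fun_mult_le:
  "0 < a \<Longrightarrow> 0 < b \<Longrightarrow> divisor_fun k (a * b) \<le> divisor_fun k a * divisor_fun k b"
proof (induction k arbitrary: a b)
  case (Suc k)
  let ?D = "{x. x dvd a} \<times> {y. y dvd b}"
  have fin: "finite ?D"
    using Suc.prems by simp
  have "divisor_fun (Suc k) (a * b) \<le> (\<Sum>d\<in>(\<lambda>(x, y). x * y) ` ?D. divisor_fun k d)"
    unfolding divisor_fun.simps
    by (intro sum_mono2 finite_imageI fin)
       (auto simp: divisor_fun_nonneg dest!: division_decomp)
  also have "\<dots> \<le> (\<Sum>(x, y)\<in>?D. divisor_fun k (x * y))"
    by (rule order_trans[OF sum_image_le[OF fin]]) (auto simp: divisor_fun_nonneg intro!: sum_mono)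
  also have "\<dots> \<le> (\<Sum>(x, y)\<in>?D. divisor_fun k x * divisor_fun k y)"
    using dvd_pos_nat[OF Suc.prems(1)] dvd_pos_nat[OF Suc.prems(2)]
    by (intro sum_mono) (auto intro!: Suc.IH)
  also have "\<dots> = divisor_fun (Suc k) a * divisor_fun (Suc k) b"
    by (simp add: sum_product sum.cartesian_product)
  finally show ?case .
qed simp

text \<open>Telescoping: \<open>ln u \<le> u - 1\<close> at \<open>u = N / (N + 1)\<close> bounds
  each new term by a difference of logarithms.\<close>

lemma sum_inverse_le_ln:
  assumes "1 \<le> N"
  shows "(\<Sum>d=1..N. 1 / real d) \<le> 1 + ln (real N)"
  using assms
proof (induction N rule: dec_induct)
  case (step N)
  have "ln (real N / real (Suc N)) \<le> real N / real (Suc N) - 1"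
    using step by (intro ln_le_minus_one) simp
  then have "1 / real (Suc N) \<le> ln (real (Suc N)) - ln (real N)"
    using step by (simp add: ln_div field_simps)
  then show ?case
    using step by simp
qed simp

text \<open>Write \<open>r = d * e\<close> and sum over the cofactor \<open>d\<close> outside. The
  induction hypothesis at \<open>N div d\<close> gives a factor \<open>N / d\<close>, and the
  harmonic sum over \<open>d\<close> supplies one more logarithm.\<close>

lemma sum_divisor_fun_le:
  "(\<Sum>r=1..N. divisor_fun k r) \<le> real N * (1 + ln (real N)) ^ k"
proof (induction k arbitrary: N)
  case (Suc k)
  show ?case
  proof (cases "N = 0")
    case False
    have "(\<Sum>r=1..N. divisor_fun (Suc k) r) = (\<Sum>(r, e)\<in>(SIGMA r:{1..N}. {e. e dvd r}). divisor_fun k e)"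
      by (simp add: sum.Sigma)
    also have "\<dots> = (\<Sum>(d, e)\<in>(SIGMA d:{1..N}. {1..N div d}). divisor_fun k e)"
    proof (rule sum.reindex_bij_witness[of _ "\<lambda>(d, e). (d * e, e)" "\<lambda>(r, e). (r div e, e)"], goal_cases)
      case (2 x)
      then obtain r e where re: "x = (r, e)" "1 \<le> r" "r \<le> N" "e dvd r"
        by auto
      from re(4) obtain d where d: "r = e * d" ..
      then have "d \<le> N"
        using re(2,3) by (intro order_trans[OF dvd_imp_le[of d r]]) simp_all
      with d re show ?case
        by (auto simp: less_eq_div_iff_mult_less_eq Suc_le_eq mult.commute)
    next
      case (4 x)
      then obtain d e where de: "x = (d, e)" "1 \<le> d" "1 \<le> e" "e \<le> N div d"
        by auto
      then have "e * d \<le> N"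
        by (simp add: less_eq_div_iff_mult_less_eq)
      with de show ?case
        by (auto simp: Suc_le_eq mult.commute)
    qed auto
    also have "\<dots> = (\<Sum>d=1..N. \<Sum>e=1..N div d. divisor_fun k e)"
      by (simp add: sum.Sigma)
    also have "\<dots> \<le> (\<Sum>d=1..N. real N * (1 + ln (real N)) ^ k * (1 / real d))"
    proof (rule sum_mono)
      fix d assume d: "d \<in> {1..N}"
      have "(\<Sum>e=1..N div d. divisor_fun k e) \<le> real (N div d) * (1 + ln (real (N div d))) ^ k"
        by (rule Suc.IH)
      also have "\<dots> \<le> (real N / real d) * (1 + ln (real N)) ^ k"
      proof (intro mult_mono power_mono)
        show "real (N div d) \<le> real N / real d"
          by (rule of_nat_div_le_of_nat)
        have "1 \<le> N div d"
          using d by (simp add: less_eq_div_iff_mult_less_eq)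
        then have "0 \<le> ln (real (N div d))" "ln (real (N div d)) \<le> ln (real N)"
          using div_le_dividend[of N d] by (auto intro!: ln_mono simp del: div_le_dividend)
        then show "1 + ln (real (N div d)) \<le> 1 + ln (real N)" "0 \<le> 1 + ln (real (N div d))"
            "0 \<le> (1 + ln (real (N div d))) ^ k"
          by simp_all
      qed simp
      finally show "(\<Sum>e=1..N div d. divisor_fun k e) \<le> real N * (1 + ln (real N)) ^ k * (1 / real d)"
        by simp
    qed
    also have "\<dots> = real N * (1 + ln (real N)) ^ k * (\<Sum>d=1..N. 1 / real d)"
      by (rule sum_distrib_left[symmetric])
    also have "\<dots> \<le> real N * (1 + ln (real N)) ^ k * (1 + ln (real N))"
      using False by (intro mult_left_mono sum_inverse_le_ln) simp_all
    finally show ?thesis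
      by (simp add: mult_ac)
  qed simp
qed simp

text \<open>Submultiplicativity splits off one variable at a time; \<open>r\<close> is general
  because it collects the factors already chosen.\<close>

lemma box_sum_divisor_fun_le:
  "0 < r \<Longrightarrow> box_sum N k (divisor_fun j) r \<le> divisor_fun j r * (\<Sum>h=1..N. divisor_fun j h) ^ k"
proof (induction k arbitrary: r)
  case (Suc k)
  let ?D = "\<Sum>h=1..N. divisor_fun j h"
  have D: "0 \<le> ?D"
    by (simp add: sum_nonneg divisor_fun_nonneg)
  have "box_sum N (Suc k) (divisor_fun j) r \<le> (\<Sum>h=1..N. divisor_fun j (r * h) * ?D ^ k)"
    using Suc.prems unfolding box_sum.simps by (intro sum_mono Suc.IH) simp
  also have "\<dots> \<le> (\<Sum>h=1..N. divisor_fun j r * divisor_fun j h * ?D ^ k)"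
    using Suc.prems D by (intro sum_mono mult_right_mono divisor_fun_mult_le) simp_all
  also have "\<dots> = divisor_fun j r * ?D ^ Suc k"
    by (simp add: mult_ac flip: sum_distrib_left sum_distrib_right)
  finally show ?case .
qed simp

section \<open>Counting representations as products\<close>

text \<open>The number of \<open>(h\<^sub>1, \<dots>, h\<^sub>k)\<close> in \<open>{1..N} ^ k\<close> with product \<open>t\<close>.\<close>

fun rep_count :: "nat \<Rightarrow> nat \<Rightarrow> nat \<Rightarrow> real" where
  "rep_count N 0 t = (if t = 1 then 1 else 0)"
| "rep_count N (Suc k) t = (\<Sum>s=1..N ^ k. \<Sum>h=1..N. if h * s = t then rep_count N k s else 0)"

lemma rep_count_nonneg: "0 \<le> rep_count N k t"
  by (induction k arbitrary: t) (simp_all add: sum_nonneg)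

text \<open>Grouping the tuples by their product prepares the application of Cauchy-Schwarz.\<close>

lemma box_sum_eq_sum_rep_count: "box_sum N k F r = (\<Sum>t=1..N ^ k. rep_count N k t * F (r * t))"
proof (induction k arbitrary: r)
  case 0
  have "{1..N ^ 0} = {1}"
    by auto
  then show ?case by simp
next
  case (Suc k)
  have "(\<Sum>t=1..N ^ Suc k. rep_count N (Suc k) t * F (r * t))
      = (\<Sum>t=1..N ^ Suc k. \<Sum>s=1..N ^ k. \<Sum>h=1..N. if h * s = t then rep_count N k s * F (r * t) else 0)"
    by (simp add: sum_distrib_right if_distrib[of "\<lambda>x. x * _"] cong: if_cong)
  also have "\<dots> = (\<Sum>s=1..N ^ k. \<Sum>h=1..N. \<Sum>t=1..N ^ Suc k. if h * s = t then rep_count N k s * F (r * t) else 0)"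
    by (subst sum.swap, rule sum.cong[OF refl], rule sum.swap)
  also have "\<dots> = (\<Sum>s=1..N ^ k. \<Sum>h=1..N. rep_count N k s * F (r * (h * s)))"
  proof (intro sum.cong refl)
    fix s h assume "s \<in> {1..N ^ k}" "h \<in> {1..N}"
    then have "h * s \<in> {1..N ^ Suc k}"
      by (simp add: mult_le_mono Suc_le_eq)
    then show "(\<Sum>t=1..N ^ Suc k. if h * s = t then rep_count N k s * F (r * t) else 0)
                 = rep_count N k s * F (r * (h * s))"
      by (simp only: sum.delta' finite_atLeastAtMost if_True)
  qed
  also have "\<dots> = box_sum N (Suc k) F r"
    by (subst sum.swap) (simp add: Suc.IH mult_ac)
  finally show ?case ..
qed

text \<open>Dropping the restriction of the factors to at most \<open>N\<close> only adds
  factorisations.\<close>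

lemma rep_count_le_divisor_fun: "0 < t \<Longrightarrow> rep_count N (Suc k) t \<le> divisor_fun k t"
proof (induction k arbitrary: t)
  case 0
  have "{1..N ^ 0} = {1}"
    by auto
  then have "rep_count N (Suc 0) t = (\<Sum>s\<in>{1}. \<Sum>h=1..N. if h * s = t then rep_count N 0 s else 0)"
    by (simp only: rep_count.simps(2))
  then show ?case
    by (simp add: sum.delta)
next
  case (Suc k)
  have "rep_count N (Suc (Suc k)) t \<le> (\<Sum>s=1..N ^ Suc k. if s dvd t then divisor_fun k s else 0)"
    unfolding rep_count.simps(2)[of N "Suc k"]
  proof (rule sum_mono)
    fix s assume s: "s \<in> {1..N ^ Suc k}"
    \<comment> \<open>Since \<open>s > 0\<close>, the only possible \<open>h\<close> is
      \<open>t div s\<close>, and it occurs only if \<open>s dvd t\<close>.\<close>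
    have "(\<Sum>h=1..N. if h * s = t then rep_count N (Suc k) s else 0)
        \<le> (\<Sum>h=1..N. if h = t div s then (if s dvd t then divisor_fun k s else 0) else 0)"
      using s Suc.IH[of s] by (intro sum_mono) (auto simp del: rep_count.simps simp: divisor_fun_nonneg)
    also have "\<dots> \<le> (if s dvd t then divisor_fun k s else 0)"
      by (simp add: sum.delta divisor_fun_nonneg)
    finally show "(\<Sum>h=1..N. if h * s = t then rep_count N (Suc k) s else 0)
        \<le> (if s dvd t then divisor_fun k s else 0)" .
  qed
  also have "\<dots> = (\<Sum>s\<in>{s\<in>{1..N ^ Suc k}. s dvd t}. divisor_fun k s)"
    by (simp only: sum.inter_filter finite_atLeastAtMost)
  also have "\<dots> \<le> divisor_fun (Suc k) t"
    unfolding divisor_fun.simps using Suc.prems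
    by (intro sum_mono2) (auto simp: divisor_fun_nonneg)
  finally show ?case .
qed

text \<open>Only one of the two factors is replaced by the divisor function; the other turns the sum
  back into a box sum, to which submultiplicativity applies.\<close>

lemma sum_rep_count_squared_le:
  "(\<Sum>t=1..N ^ Suc k. (rep_count N (Suc k) t)\<^sup>2) \<le> (real N * (1 + ln (real N)) ^ k) ^ Suc k"
proof -
  have "(\<Sum>t=1..N ^ Suc k. (rep_count N (Suc k) t)\<^sup>2)
      \<le> (\<Sum>t=1..N ^ Suc k. rep_count N (Suc k) t * divisor_fun k (1 * t))"
    by (intro sum_mono)
       (auto simp: power2_eq_square rep_count_nonneg simp del: rep_count.simps
             intro!: mult_left_mono rep_count_le_divisor_fun)
  also have "\<dots> = box_sum N (Suc k) (divisor_fun k) 1"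
    by (rule box_sum_eq_sum_rep_count[symmetric])
  also have "\<dots> \<le> divisor_fun k 1 * (\<Sum>h=1..N. divisor_fun k h) ^ Suc k"
    by (rule box_sum_divisor_fun_le) simp
  also have "divisor_fun k 1 = 1"
    by (induction k) simp_all
  also have "1 * (\<Sum>h=1..N. divisor_fun k h) ^ Suc k \<le> (real N * (1 + ln (real N)) ^ k) ^ Suc k"
    unfolding mult_1
    by (intro power_mono sum_divisor_fun_le sum_nonneg divisor_fun_nonneg)
  finally show ?thesis .
qed

lemma box_sum_squared_le:
  "(box_sum N (Suc k) F 1)\<^sup>2
     \<le> (real N * (1 + ln (real N)) ^ k) ^ Suc k * (\<Sum>t=1..N ^ Suc k. (F t)\<^sup>2)"
proof -
  have "(box_sum N (Suc k) F 1)\<^sup>2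
      \<le> (\<Sum>t=1..N ^ Suc k. (rep_count N (Suc k) t)\<^sup>2) * (\<Sum>t=1..N ^ Suc k. (F t)\<^sup>2)"
    unfolding box_sum_eq_sum_rep_count mult_1 by (rule Cauchy_Schwarz_ineq_sum)
  also have "\<dots> \<le> (real N * (1 + ln (real N)) ^ k) ^ Suc k * (\<Sum>t=1..N ^ Suc k. (F t)\<^sup>2)"
    by (intro mult_right_mono sum_rep_count_squared_le sum_nonneg) simp
  finally show ?thesis .
qed

text \<open>A weak form of Jordan's inequality. For \<open>x \<le> 1 / 2\<close> put
  \<open>s = pi * x / 2 \<le> pi / 4\<close>: the cosine is at least \<open>sqrt 2 / 2\<close> on
  \<open>[0, s]\<close>, so \<open>sin (2 * s) = 2 * sin s * cos s \<ge> s \<ge> x\<close>.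
  Reflection covers the rest.\<close>

lemma min_le_sin_pi:
  assumes "0 \<le> x" "x \<le> 1"
  shows "min x (1 - x) \<le> sin (pi * x)"
proof -
  have half: "x \<le> sin (pi * x)" if x: "0 \<le> x" "x \<le> 1 / 2" for x :: real
  proof (cases "x = 0")
    case False
    define s where "s = pi * x / 2"
    have s: "0 < s" "s \<le> pi / 4"
      using x False by (simp_all add: s_def mult_left_le)
    have "\<exists>z. 0 < z \<and> z < s \<and> sin s - sin 0 = (s - 0) * cos z"
      by (rule MVT2[OF s(1)]) (auto intro!: derivative_eq_intros)
    then obtain z where z: "0 < z" "z < s" "sin s = s * cos z"
      by auto
    have cos_s: "sqrt 2 / 2 \<le> cos s"
      unfolding cos_45[symmetric] using s pi_gt_zero by (intro cos_monotone_0_pi_le) auto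
    have "cos s \<le> cos z"
      using z s pi_gt_zero by (intro cos_monotone_0_pi_le) auto
    then have "s * (sqrt 2 / 2) \<le> sin s"
      using z(3) s cos_s by (simp add: mult_left_mono)
    then have "2 * (s * (sqrt 2 / 2)) * (sqrt 2 / 2) \<le> 2 * sin s * cos s"
      using s cos_s pi_gt_zero by (intro mult_mono) (auto intro!: sin_ge_zero)
    also have "\<dots> = sin (pi * x)"
      using sin_double[of s] by (simp add: s_def)
    finally have "s \<le> sin (pi * x)"
      by (simp add: mult.assoc)
    moreover have "x \<le> s"
      unfolding s_def using x pi_gt3 mult_right_mono[of 2 pi x] by simp
    ultimately show ?thesis by simp
  qed simp
  show ?thesis
  proof (cases "x \<le> 1 / 2")
    case True
    then show ?thesis
      using half[of x] assms by simp
  next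
    case False
    then have "1 - x \<le> sin (pi * (1 - x))"
      using assms by (intro half) simp_all
    also have "\<dots> = sin (pi * x)"
      by (simp add: right_diff_distrib)
    finally show ?thesis
      by simp
  qed
qed

section \<open>Sums over residue classes\<close>

text \<open>The distance of \<open>x\<close> to 0 or to 1 governs the sine. The lower bound on
  \<open>x\<close> is weakened from \<open>w - 1\<close> to \<open>w - 2\<close> so that both ends
  share one \<open>\<psi>\<close>; residues within 2 of an end take the trivial bound
  \<open>N\<close>.\<close>

lemma linear_bound_near_fraction_le:
  fixes w q N :: nat and x :: real
  assumes "w < q" "real w - 1 \<le> real q * x" "real q * x \<le> real w + 2"
  defines "\<psi> \<equiv> \<lambda>v. (if v < 3 then real N else 0) + real q / real (v - 2)"
  shows "linear_bound N x \<le> \<psi> w + \<psi> (q - w)"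
proof -
  \<comment> \<open>For \<open>v \<le> 2\<close> the second summand of \<open>\<psi> v\<close> is \<open>q / 0 = 0\<close>.\<close>
  have \<psi>: "0 \<le> \<psi> v" "v < 3 \<Longrightarrow> real N \<le> \<psi> v" for v
    by (simp_all add: \<psi>_def)
  consider "w < 3" | "q - w < 3" | "3 \<le> w" "3 \<le> q - w"
    by linarith
  then show ?thesis
  proof cases
    case 1
    then show ?thesis
      using \<psi>(1)[of "q - w"] \<psi>(2)[of w] linear_bound_le[of N x] by linarith
  next
    case 2
    then show ?thesis
      using \<psi>(1)[of w] \<psi>(2)[of "q - w"] linear_bound_le[of N x] by linarith
  next
    case 3
    have q: "0 < real q"
      using assms(1) by simp
    have lower: "real (w - 2) / real q \<le> x"
      using 3 assms q by (simp add: field_simps of_nat_diff)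
    have upper: "real (q - w - 2) / real q \<le> 1 - x"
      using 3 assms q by (simp add: field_simps of_nat_diff)
    have pos: "0 < real (w - 2) / real q" "0 < real (q - w - 2) / real q"
      using 3 q by simp_all
    have sin: "min x (1 - x) \<le> \<bar>sin (pi * x)\<bar>"
      using min_le_sin_pi[of x] lower upper pos by linarith
    show ?thesis
    proof (cases "x \<le> 1 - x")
      case True
      then have "linear_bound N x \<le> 1 / (real (w - 2) / real q)"
        using sin lower pos by (intro linear_bound_le_inverse) linarith+
      also have "\<dots> \<le> \<psi> w"
        by (simp add: \<psi>_def)
      finally show ?thesis
        using \<psi>(1)[of "q - w"] by linarith
    next
      case False
      then have "linear_bound N x \<le> 1 / (real (q - w - 2) / real q)"
        using sin upper pos by (intro linear_bound_le_inverse) linarith+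
      also have "\<dots> \<le> \<psi> (q - w)"
        by (simp add: \<psi>_def)
      finally show ?thesis
        using \<psi>(1)[of w] by linarith
    qed
  qed
qed

text \<open>Multiplication by \<open>a\<close> is injective modulo \<open>q\<close>, and an
  injective self-map of a finite set is onto.\<close>

lemma bij_betw_affine_residues:
  fixes a b :: int and q :: nat
  assumes "1 \<le> q" "coprime a (int q)"
  shows "bij_betw (\<lambda>u. nat ((b + a * int u) mod int q)) {..<q} {..<q}"
proof -
  let ?w = "\<lambda>u. nat ((b + a * int u) mod int q)"
  have range: "?w ` {..<q} \<subseteq> {..<q}"
    using assms(1) by (auto simp: nat_less_iff)
  have "inj_on ?w {..<q}"
  proof (rule inj_onI)
    fix u v assume uv: "u \<in> {..<q}" "v \<in> {..<q}" "?w u = ?w v"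
    then have "(b + a * int u) mod int q = (b + a * int v) mod int q"
      using assms(1) by (simp add: nat_eq_iff)
    then have "int q dvd a * (int u - int v)"
      by (simp add: mod_eq_dvd_iff right_diff_distrib)
    then have "int q dvd int u - int v"
      using assms(2) by (simp add: coprime_dvd_mult_right_iff coprime_commute)
    then have "int u mod int q = int v mod int q"
      by (simp add: mod_eq_dvd_iff)
    then show "u = v"
      using uv by simp
  qed
  then show ?thesis
    using range by (simp add: bij_betw_def endo_inj_surj)
qed

text \<open>Up to bounded errors, \<open>q * (\<gamma> + \<alpha> * u)\<close> is
  \<open>b + a * u\<close>, which meets each residue modulo \<open>q\<close> once. This leaves a
  harmonic sum and a few trivial terms.\<close>

lemma sum_linear_bound_block_le:
  fixes a :: int and q :: nat
  assumes q: "1 \<le> q" and cop: "coprime a (int q)"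
    and approx: "\<bar>\<alpha> - of_int a / of_nat q\<bar> \<le> 1 / (of_nat q)\<^sup>2"
  shows "(\<Sum>u<q. linear_bound N (\<gamma> + \<alpha> * real u)) \<le> 6 * real N + 2 * real q * (1 + ln (real q))"
proof -
  define b where "b = \<lfloor>real q * \<gamma>\<rfloor>"
  define w where "w u = nat ((b + a * int u) mod int q)" for u
  define \<psi> where "\<psi> v = (if v < 3 then real N else 0) + real q / real (v - 2)" for v
  have \<psi>_nonneg: "0 \<le> \<psi> v" for v
    by (simp add: \<psi>_def)
  have point: "linear_bound N (\<gamma> + \<alpha> * real u) \<le> \<psi> (w u) + \<psi> (q - w u)" if u: "u < q" for u
  proof -
    define k where "k = (b + a * int u) div int q"
    define x where "x = \<gamma> + \<alpha> * real u - of_int k"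
    define \<theta> where "\<theta> = \<alpha> - of_int a / real q"
    have w_lt: "w u < q"
      using q by (simp add: w_def nat_less_iff)
    have "int (w u) = b + a * int u - int q * k"
      using q by (simp add: w_def k_def minus_mult_div_eq_mod)
    then have "real_of_int (int (w u)) = real_of_int (b + a * int u - int q * k)"
      by (rule arg_cong)
    then have w_eq: "real (w u) = of_int b + of_int a * real u - real q * of_int k"
      by simp
    have "real q * x = real (w u) + (real q * \<gamma> - of_int b) + \<theta> * (real u * real q)"
      using q by (simp add: w_eq x_def \<theta>_def field_simps)
    \<comment> \<open>Rounding \<open>q * \<gamma>\<close> down costs an error in
      \<open>[0, 1]\<close> and replacing \<open>\<alpha>\<close> by \<open>a / q\<close> one in
      \<open>[-1, 1]\<close>: together the window from \<open>w - 1\<close> to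
      \<open>w + 2\<close>.\<close>
    moreover have "0 \<le> real q * \<gamma> - of_int b" "real q * \<gamma> - of_int b \<le> 1"
      unfolding b_def by linarith+
    moreover have "\<bar>\<theta> * (real u * real q)\<bar> \<le> 1"
    proof -
      have "\<bar>\<theta> * (real u * real q)\<bar> \<le> 1 / (real q)\<^sup>2 * (real q * real q)"
        unfolding abs_mult using approx u
        by (intro mult_mono) (auto simp: \<theta>_def)
      also have "\<dots> = 1"
        using q by (simp add: power2_eq_square)
      finally show ?thesis .
    qed
    ultimately have "real (w u) - 1 \<le> real q * x" "real q * x \<le> real (w u) + 2"
      by linarith+
    from linear_bound_near_fraction_le[OF w_lt this, of N]
    have "linear_bound N x \<le> \<psi> (w u) + \<psi> (q - w u)"
      by (simp add: \<psi>_def)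
    moreover have "linear_bound N (\<gamma> + \<alpha> * real u) = linear_bound N x"
      using linear_bound_add_int[of N x k] by (simp add: x_def)
    ultimately show ?thesis by simp
  qed
  \<comment> \<open>At \<open>v = 0, 1, 2\<close> the quotient in \<open>\<psi> v\<close> is a
    division by zero with value 0, so only \<open>N\<close> counts; from \<open>v = 3\<close> on,
    \<open>d = v - 2\<close>.\<close>
  have \<psi>_sum: "(\<Sum>v<M + 3. \<psi> v) = 3 * real N + real q * (\<Sum>d=1..M. 1 / real d)" for M
  proof (induction M)
    case 0
    show ?case
      by (simp add: \<psi>_def eval_nat_numeral)
  next
    case (Suc M)
    have "\<psi> (M + 3) = real q * (1 / real (Suc M))"
      by (simp add: \<psi>_def numeral_3_eq_3)
    then show ?case
      unfolding add_Suc sum.lessThan_Suc Suc by (simp add: distrib_left)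
  qed
  have \<psi>_total: "(\<Sum>v<q + 3. \<psi> v) \<le> 3 * real N + real q * (1 + ln (real q))"
    unfolding \<psi>_sum using sum_inverse_le_ln[OF q] by (simp add: mult_left_mono)
  have "(\<Sum>u<q. linear_bound N (\<gamma> + \<alpha> * real u)) \<le> (\<Sum>u<q. \<psi> (w u) + \<psi> (q - w u))"
    by (intro sum_mono point) simp
  also have "\<dots> = (\<Sum>v<q. \<psi> v + \<psi> (q - v))"
    using sum.reindex_bij_betw[OF bij_betw_affine_residues[OF q cop, of b], of "\<lambda>v. \<psi> v + \<psi> (q - v)"]
    by (simp add: w_def)
  also have "\<dots> = (\<Sum>v<q. \<psi> v) + (\<Sum>v\<in>{1..q}. \<psi> v)"
  proof -
    have "(\<Sum>v<q. \<psi> (q - v)) = (\<Sum>v\<in>{1..q}. \<psi> v)"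
      by (rule sum.reindex_bij_witness[of _ "\<lambda>v. q - v" "\<lambda>v. q - v"]) auto
    then show ?thesis
      by (simp add: sum.distrib)
  qed
  also have "\<dots> \<le> (\<Sum>v<q + 3. \<psi> v) + (\<Sum>v<q + 3. \<psi> v)"
    by (intro add_mono sum_mono2) (auto simp: \<psi>_nonneg)
  also have "\<dots> \<le> 6 * real N + 2 * real q * (1 + ln (real q))"
    using \<psi>_total by linarith
  finally show ?thesis .
qed

text \<open>The range is covered by \<open>X div q + 1\<close> blocks of length \<open>q\<close>;
  the start of each block is absorbed into the free shift \<open>\<gamma>\<close>.\<close>

lemma sum_linear_bound_le:
  fixes a :: int and q :: nat
  assumes q: "1 \<le> q" and cop: "coprime a (int q)"
    and approx: "\<bar>\<alpha> - of_int a / of_nat q\<bar> \<le> 1 / (of_nat q)\<^sup>2"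
  shows "(\<Sum>t=1..X. linear_bound N (\<alpha> * real t))
           \<le> (real X / real q + 1) * (6 * real N + 2 * real q * (1 + ln (real q)))"
proof -
  define M where "M = X div q + 1"
  let ?f = "\<lambda>t. linear_bound N (\<alpha> * real (Suc t))"
  let ?B = "6 * real N + 2 * real q * (1 + ln (real q))"
  have B: "0 \<le> ?B"
    using q by simp
  have "X \<le> M * q"
    using q dividend_less_div_times[of q X] by (simp add: M_def)
  have "(\<Sum>t=1..X. linear_bound N (\<alpha> * real t)) = (\<Sum>t<X. ?f t)"
    by (simp add: sum.atLeast1_atMost_eq)
  also have "\<dots> \<le> (\<Sum>t<M * q. ?f t)"
    using \<open>X \<le> M * q\<close> by (intro sum_mono2) (auto simp: linear_bound_nonneg)
  also have "\<dots> = (\<Sum>m<M. \<Sum>t\<in>{m * q..<m * q + q}. ?f t)"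
    by (rule sum.nat_group[symmetric])
  also have "\<dots> \<le> (\<Sum>m<M. ?B)"
  proof (rule sum_mono)
    fix m
    have "(\<Sum>t\<in>{m * q..<m * q + q}. ?f t) = (\<Sum>u<q. linear_bound N (\<alpha> * real (Suc (m * q)) + \<alpha> * real u))"
      by (rule sum.reindex_bij_witness[of _ "\<lambda>u. m * q + u" "\<lambda>t. t - m * q"])
         (auto simp: algebra_simps of_nat_diff)
    also have "\<dots> \<le> ?B"
      by (rule sum_linear_bound_block_le[OF assms])
    finally show "(\<Sum>t\<in>{m * q..<m * q + q}. ?f t) \<le> ?B" .
  qed
  also have "\<dots> = (real (X div q) + 1) * ?B"
    by (simp add: M_def)
  also have "\<dots> \<le> (real X / real q + 1) * ?B"
    by (intro mult_right_mono add_right_mono of_nat_div_le_of_nat B)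
  finally show ?thesis .
qed

text \<open>With \<open>c = n!\<close>, passing from multiples of \<open>c\<close> to all integers
  keeps the rational approximation to \<open>\<alpha>\<close> itself usable.\<close>

lemma sum_linear_bound_multiples_squared_le:
  assumes "1 \<le> c"
  shows "(\<Sum>t=1..X. (linear_bound N (\<alpha> * real (c * t)))\<^sup>2)
           \<le> real N * (\<Sum>t=1..c * X. linear_bound N (\<alpha> * real t))"
proof -
  have "(\<Sum>t=1..X. (linear_bound N (\<alpha> * real (c * t)))\<^sup>2)
      \<le> (\<Sum>t=1..X. real N * linear_bound N (\<alpha> * real (c * t)))"
    unfolding power2_eq_square
    by (intro sum_mono mult_right_mono linear_bound_le linear_bound_nonneg)
  also have "\<dots> = real N * (\<Sum>t\<in>(*) c ` {1..X}. linear_bound N (\<alpha> * real t))"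
    using assms by (subst sum.reindex) (auto simp: inj_on_def sum_distrib_left)
  also have "\<dots> \<le> real N * (\<Sum>t=1..c * X. linear_bound N (\<alpha> * real t))"
    using assms by (intro mult_left_mono sum_mono2) (auto simp: linear_bound_nonneg Suc_le_eq)
  finally show ?thesis .
qed

text \<open>Differencing bounds the power \<open>2 ^ k\<close>; Cauchy-Schwarz controls the square
  of the box sum, hence the exponent \<open>2 ^ n\<close> with \<open>n = k + 1\<close>.\<close>

lemma weyl_inequality_explicit:
  fixes a :: int and q :: nat and j N :: nat
  defines "k \<equiv> Suc j" and "n \<equiv> Suc (Suc j)"
  assumes q: "1 \<le> q" and cop: "coprime a (int q)"
    and approx: "\<bar>\<alpha> - of_int a / of_nat q\<bar> \<le> 1 / (of_nat q)\<^sup>2"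
    and len: "B - A < int N"
  shows "norm (\<Sum>m\<in>{A..B}. e_exp (\<alpha> * of_int m ^ n)) ^ (2 ^ n)
    \<le> (2 * real N) ^ (2 ^ n - 2 * n) * (2 * (4 ^ k * ((real N * (1 + ln (real N)) ^ j) ^ k
         * (real N * ((fact n * real N ^ k / real q + 1) * (6 * real N + 2 * real q * (1 + ln (real q))))))
         + (real k)\<^sup>2 * (2 * real N) ^ (2 * k)))"
proof -
  define S where "S = norm (\<Sum>m\<in>{A..B}. e_exp (\<alpha> * of_int m ^ n))"
  define c :: nat where "c = fact n"
  define P where "P = box_sum N k (\<lambda>s. linear_bound N (\<alpha> * real (c * s))) 1"
  define V where "V = weyl_sum N k (linear_bound N) (\<alpha> * fact n)"
  let ?E = "real k * (2 * real N) ^ k / 2"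
  have exp: "2 ^ n - 2 * n = (2 ^ k - n) * 2"
    by (simp add: n_def k_def)
  have "has_top_difference n (\<alpha> * fact n) (\<lambda>m. \<alpha> * of_int m ^ n)"
    using has_top_difference_power[of n n] by (intro has_top_difference_cmult) simp
  then have S: "S ^ (2 ^ k) \<le> (2 * real N) ^ (2 ^ k - n) * V"
    unfolding S_def V_def n_def k_def using len by (rule weyl_differencing)
  have V: "V \<le> 2 ^ k * P + ?E"
    using weyl_sum_le_box_sum[of "linear_bound N" N k "\<alpha> * fact n" 1]
    by (simp add: V_def P_def c_def linear_bound_nonneg linear_bound_le mult_ac)
  have V_nonneg: "0 \<le> V"
    by (simp add: V_def weyl_sum_nonneg linear_bound_nonneg)
  have "P\<^sup>2 \<le> (real N * (1 + ln (real N)) ^ j) ^ k * (\<Sum>t=1..N ^ k. (linear_bound N (\<alpha> * real (c * t)))\<^sup>2)"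
    unfolding P_def k_def by (rule box_sum_squared_le)
  also have "\<dots> \<le> (real N * (1 + ln (real N)) ^ j) ^ k
      * (real N * ((fact n * real N ^ k / real q + 1) * (6 * real N + 2 * real q * (1 + ln (real q)))))"
  proof (rule mult_left_mono)
    have "(\<Sum>t=1..N ^ k. (linear_bound N (\<alpha> * real (c * t)))\<^sup>2)
        \<le> real N * (\<Sum>t=1..c * N ^ k. linear_bound N (\<alpha> * real t))"
      by (rule sum_linear_bound_multiples_squared_le) (simp add: c_def)
    also have "\<dots> \<le> real N * ((real (c * N ^ k) / real q + 1) * (6 * real N + 2 * real q * (1 + ln (real q))))"
      by (intro mult_left_mono sum_linear_bound_le[OF q cop approx]) simp
    finally show "(\<Sum>t=1..N ^ k. (linear_bound N (\<alpha> * real (c * t)))\<^sup>2)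
        \<le> real N * ((fact n * real N ^ k / real q + 1) * (6 * real N + 2 * real q * (1 + ln (real q))))"
      by (simp add: c_def)
    have "0 \<le> ln (real N)"
      by (cases "N = 0") simp_all
    then show "0 \<le> (real N * (1 + ln (real N)) ^ j) ^ k"
      by simp
  qed
  finally have P: "P\<^sup>2 \<le> (real N * (1 + ln (real N)) ^ j) ^ k
      * (real N * ((fact n * real N ^ k / real q + 1) * (6 * real N + 2 * real q * (1 + ln (real q)))))" .
  have "V\<^sup>2 \<le> (2 ^ k * P + ?E)\<^sup>2"
    by (intro power_mono V V_nonneg)
  also have "\<dots> \<le> 2 * ((2 ^ k * P)\<^sup>2 + ?E\<^sup>2)"
    using sum_squares_bound[of "2 ^ k * P" ?E] by (simp add: power2_sum)
  also have "(2 ^ k * P)\<^sup>2 = 4 ^ k * P\<^sup>2"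
    using power_mult_distrib[of "2::real" 2 k] by (simp add: power_mult_distrib power2_eq_square)
  also have "?E\<^sup>2 = (real k)\<^sup>2 * (2 * real N) ^ (2 * k) / 4"
    unfolding power_divide power_mult_distrib[of "real k"] power_even_eq by simp
  also have "2 * (4 ^ k * P\<^sup>2 + (real k)\<^sup>2 * (2 * real N) ^ (2 * k) / 4)
      \<le> 2 * (4 ^ k * ((real N * (1 + ln (real N)) ^ j) ^ k
         * (real N * ((fact n * real N ^ k / real q + 1) * (6 * real N + 2 * real q * (1 + ln (real q))))))
         + (real k)\<^sup>2 * (2 * real N) ^ (2 * k))"
    by (intro mult_left_mono add_mono P) simp_all
  finally have V2: "V\<^sup>2 \<le> \<dots>" .
  have "S ^ (2 ^ n) = (S ^ (2 ^ k))\<^sup>2"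
    by (simp add: n_def k_def flip: power_mult)
  also have "\<dots> \<le> ((2 * real N) ^ (2 ^ k - n) * V)\<^sup>2"
    by (intro power_mono S) (simp add: S_def)
  also have "\<dots> = (2 * real N) ^ (2 ^ n - 2 * n) * V\<^sup>2"
    unfolding exp by (simp add: power_mult_distrib power_mult)
  finally show ?thesis
    unfolding S_def[symmetric] by (rule order_trans[OF _ mult_left_mono[OF V2]]) simp
qed

section \<open>Final estimate\<close>

text \<open>The hypothesis \<open>exp 1 \<le> y\<close> gives \<open>L \<ge> 1\<close>, so all
  logarithms fit into powers of \<open>L\<close>. Multiplying out
  \<open>(N ^ k / q + 1) * (N + q)\<close> and dividing by \<open>N ^ n\<close> yields the terms of
  \<open>\<Delta>\<close>.\<close>

lemma weyl_main_term_le: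
  fixes N q j k n :: nat and y :: real
  defines "k \<equiv> Suc j" and "n \<equiv> Suc (Suc j)" and "L \<equiv> ln (real q * y)"
    and "\<Delta> \<equiv> 1 / real q + 1 / y + real q / y ^ n"
  assumes q: "1 \<le> q" and y: "exp 1 \<le> y" and N: "y \<le> real N" "real N \<le> 2 * y"
  shows "(real N * (1 + ln (real N)) ^ j) ^ k
       * (real N * ((fact n * real N ^ k / real q + 1) * (6 * real N + 2 * real q * (1 + ln (real q)))))
     \<le> (3 ^ (j * k) * fact n * 12) * (real N ^ (2 * n) * \<Delta> * L ^ (k * k))"
proof -
  have y0: "0 < y"
    using y exp_gt_zero[of "1::real"] by linarith
  have ln_y: "1 \<le> ln y"
    using y y0 by (simp add: ln_ge_iff)
  have L: "L = ln (real q) + ln y"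
    using q y0 by (simp add: L_def ln_mult)
  have ln_q: "0 \<le> ln (real q)"
    using q by simp
  have L1: "1 \<le> L"
    using L ln_q ln_y by linarith
  have N1: "1 \<le> real N"
    using N(1) y exp_ge_add_one_self[of 1] by linarith
  have Npos: "0 < real N" and qpos: "0 < real q"
    using N1 q by simp_all
  have "ln (real N) \<le> ln (2 * y)"
    using N Npos by (intro ln_mono) simp_all
  also have "\<dots> \<le> 1 + ln y"
    using y0 ln_le_minus_one[of 2] by (simp add: ln_mult)
  finally have ln_N: "1 + ln (real N) \<le> 3 * L"
    using L ln_q ln_y by linarith
  have ln_N0: "0 \<le> ln (real N)"
    using N1 by simp
  have first: "(real N * (1 + ln (real N)) ^ j) ^ k \<le> (real N * (3 * L) ^ j) ^ k"
    using ln_N ln_N0 by (intro power_mono mult_left_mono) simp_all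
  have second: "fact n * real N ^ k / real q + 1 \<le> fact n * (real N ^ k / real q + 1)"
    using fact_ge_1[of n, where 'a = real] by (simp add: distrib_left)
  have "6 * real N + 2 * real q * (1 + ln (real q)) \<le> 6 * real N * L + 6 * real q * L"
  proof (rule add_mono)
    show "6 * real N \<le> 6 * real N * L"
      using L1 by (simp add: mult_le_cancel_left1)
    have "1 + ln (real q) \<le> 3 * L"
      using L ln_q ln_y by linarith
    from mult_left_mono[OF this, of "2 * real q"]
    show "2 * real q * (1 + ln (real q)) \<le> 6 * real q * L"
      by simp
  qed
  then have third: "6 * real N + 2 * real q * (1 + ln (real q)) \<le> 6 * L * (real N + real q)"
    by (simp add: algebra_simps)
  have fourth: "(real N ^ k / real q + 1) * (real N + real q) \<le> 2 * real N ^ n * \<Delta>"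
  proof -
    have "(real N ^ k / real q + 1) * (real N + real q)
        = real N ^ n / real q + real N ^ k + real N + real q"
      using qpos by (simp add: field_simps n_def k_def)
    also have "\<dots> \<le> real N ^ n / real q + 2 * real N ^ k + real q"
      using N1 power_increasing[of 1 k "real N"] by (simp add: k_def)
    also have "\<dots> = real N ^ n * (1 / real q + 2 * (1 / real N) + real q / real N ^ n)"
      using Npos by (simp add: field_simps n_def k_def)
    also have "\<dots> \<le> real N ^ n * (1 / real q + 2 * (1 / y) + real q / y ^ n)"
      using N y0 Npos qpos
      by (intro mult_left_mono add_mono divide_left_mono power_mono mult_pos_pos zero_less_power) simp_all
    also have "\<dots> \<le> real N ^ n * (2 * \<Delta>)"
    proof (rule mult_left_mono)
      have le: "u + 2 * v + w \<le> 2 * (u + v + w)" if "0 \<le> u" "0 \<le> w" for u v w :: real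
        using that by simp
      show "1 / real q + 2 * (1 / y) + real q / y ^ n \<le> 2 * \<Delta>"
        unfolding \<Delta>_def using y0 by (intro le) simp_all
    qed simp
    finally show ?thesis
      by simp
  qed
  have \<Delta>0: "0 \<le> \<Delta>"
    using y0 by (simp add: \<Delta>_def)
  have "(real N * (1 + ln (real N)) ^ j) ^ k
       * (real N * ((fact n * real N ^ k / real q + 1) * (6 * real N + 2 * real q * (1 + ln (real q)))))
     \<le> (real N * (3 * L) ^ j) ^ k
       * (real N * ((fact n * (real N ^ k / real q + 1)) * (6 * L * (real N + real q))))"
    using L1 ln_q by (intro mult_mono first second third order_refl) auto
  also have "\<dots> = (3 ^ (j * k) * fact n * 6) * (real N ^ n * L ^ (j * k + 1)
       * ((real N ^ k / real q + 1) * (real N + real q)))"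
  proof -
    have "(real N * (3 * L) ^ j) ^ k = real N ^ k * (3 ^ (j * k) * L ^ (j * k))"
      by (simp only: power_mult_distrib power_mult)
    moreover have "real N ^ n = real N * real N ^ k"
      by (simp add: n_def k_def)
    ultimately show ?thesis
      by (simp only: power_add power_one_right mult_ac)
  qed
  also have "\<dots> \<le> (3 ^ (j * k) * fact n * 6) * (real N ^ n * L ^ (k * k) * (2 * real N ^ n * \<Delta>))"
  proof (rule mult_left_mono[OF mult_mono[OF mult_left_mono fourth]])
    \<comment> \<open>Here \<open>k * k = j * k + k\<close> exceeds the exponent by
      \<open>j\<close>.\<close>
    show "L ^ (j * k + 1) \<le> L ^ (k * k)"
      by (rule power_increasing[OF _ L1]) (simp add: k_def)
  qed (use L1 in auto)
  also have "\<dots> = (3 ^ (j * k) * fact n * 12) * (real N ^ (2 * n) * \<Delta> * L ^ (k * k))"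
    unfolding power_even_eq power2_eq_square by simp
  finally show ?thesis .
qed

lemma le_powr_of_power_le:
  fixes s c y D L :: real
  assumes "s ^ m \<le> c * y ^ m * D * L ^ E" "0 \<le> s" "0 \<le> c" "0 \<le> y" "0 \<le> D" "0 < L" "0 < m"
  shows "s \<le> c powr (1 / real m) * (y * D powr (1 / real m) * L powr (real E / real m))"
proof -
  have root: "(t ^ m) powr (1 / real m) = t" if "0 \<le> t" for t :: real
    using that \<open>0 < m\<close> by (cases "t = 0") (simp_all add: powr_powr flip: powr_realpow)
  have "s = (s ^ m) powr (1 / real m)"
    using root assms by simp
  also have "\<dots> \<le> (c * y ^ m * D * L ^ E) powr (1 / real m)"
    using assms by (intro powr_mono2) simp_all
  also have "\<dots> = c powr (1 / real m) * y * D powr (1 / real m) * (L ^ E) powr (1 / real m)"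
    using assms root[of y] by (simp add: powr_mult)
  also have "(L ^ E) powr (1 / real m) = L powr (real E / real m)"
    using assms by (simp add: powr_powr flip: powr_realpow)
  finally show ?thesis
    by (simp add: mult_ac)
qed

text \<open>Ensures that \<open>2 ^ n - 2 * n\<close> is not truncated.\<close>

lemma double_le_two_power: "3 \<le> n \<Longrightarrow> 2 * n \<le> 2 ^ n"
  by (induction n rule: dec_induct) auto

theorem theorem2:
  fixes n :: nat
  assumes "n \<ge> 3"
  shows "\<exists>x0 > 0. \<exists>C > 0. \<forall>(x::real) (y::real) (\<alpha>::real) (a::int) (q::nat).
           x \<ge> x0 \<longrightarrow> ln x < y \<longrightarrow> y \<le> x / ln x \<longrightarrow>
           q \<ge> 1 \<longrightarrow> coprime a (int q) \<longrightarrow>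
           \<bar>\<alpha> - of_int a / of_nat q\<bar> \<le> 1 / (of_nat q)\<^sup>2 \<longrightarrow>
           norm (T n \<alpha> x y) \<le>
             C * (y * (1 / of_nat q + 1 / y + of_nat q / y ^ n) powr (1 / 2 ^ n)
                    * (ln (of_nat q * y)) powr ((of_nat n - 1)\<^sup>2 / 2 ^ n))"
proof -
  define j where "j = n - 2"
  define k where "k = Suc j"
  have n: "n = Suc (Suc j)"
    using assms by (simp add: j_def)
  define c1 :: real where "c1 = 3 ^ (j * k) * fact n * 12"
  \<comment> \<open>In \<open>c2\<close> the term with \<open>4 ^ n\<close> pays for tuples with a
    zero step; in \<open>C\<close> the power of 4 comes from
    \<open>2 * N \<le> 4 * y\<close>.\<close>
  define c2 :: real where "c2 = 2 * (4 ^ k * c1 + (real k)\<^sup>2 * 4 ^ n)"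
  define C :: real where "C = (c2 * 4 ^ (2 ^ n)) powr (1 / 2 ^ n)"
  have c1: "0 < c1"
    by (simp add: c1_def)
  have c2: "0 < c2"
    using c1 by (simp add: c2_def add_pos_nonneg)
  \<comment> \<open>The threshold \<open>exp (exp 1)\<close> makes
    \<open>y > ln x \<ge> exp 1\<close>, hence \<open>ln y \<ge> 1\<close>.\<close>
  have "norm (T n \<alpha> x y) \<le>
          C * (y * (1 / real q + 1 / y + real q / y ^ n) powr (1 / 2 ^ n)
            * (ln (real q * y)) powr ((real n - 1)\<^sup>2 / 2 ^ n))"
    if x: "exp (exp 1) \<le> x" "ln x < y" and q: "1 \<le> q" and cop: "coprime a (int q)"
      and approx: "\<bar>\<alpha> - of_int a / of_nat q\<bar> \<le> 1 / (of_nat q)\<^sup>2"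
    for x y \<alpha> a q
  proof -
    define N where "N = nat \<lceil>y\<rceil>"
    define \<Delta> where "\<Delta> = 1 / real q + 1 / y + real q / y ^ n"
    define L where "L = ln (real q * y)"
    have "0 < x"
      using x(1) exp_gt_zero[of "exp (1::real)"] by linarith
    then have "exp 1 \<le> ln x"
      using x(1) by (simp add: ln_ge_iff)
    then have y: "exp 1 \<le> y"
      using x(2) by linarith
    then have y2: "2 \<le> y"
      using exp_ge_add_one_self[of 1] by linarith
    have N: "y \<le> real N" "real N \<le> 2 * y"
      using y2 by (simp_all add: N_def) linarith+
    have \<Delta>0: "0 \<le> \<Delta>" "1 / y \<le> \<Delta>"
      using y2 by (simp_all add: \<Delta>_def)
    have "1 \<le> ln y"
      using y y2 by (simp add: ln_ge_iff)
    also have "\<dots> \<le> L"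
      unfolding L_def using q y2 by (intro ln_mono) (simp_all add: mult_le_cancel_right1)
    finally have L1: "1 \<le> L" .
    have T_eq: "T n \<alpha> x y = (\<Sum>m\<in>{\<lfloor>x - y\<rfloor> + 1..\<lfloor>x\<rfloor>}. e_exp (\<alpha> * of_int m ^ n))"
      unfolding T_def by (intro sum.cong refl) (auto simp: le_floor_iff, linarith+)
    \<comment> \<open>A half-open interval of length \<open>y\<close> contains at most
      \<open>\<lceil>y\<rceil>\<close> integers.\<close>
    have len: "\<lfloor>x\<rfloor> - (\<lfloor>x - y\<rfloor> + 1) < int N"
      unfolding N_def using y2 by linarith
    define W where "W = real N ^ (2 * n) * \<Delta> * L ^ (k * k)"
    \<comment> \<open>The summand \<open>1 / y\<close> of \<open>\<Delta>\<close> absorbs the zero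
      steps, since \<open>N ^ 2 * \<Delta> \<ge> y \<ge> 1\<close>.\<close>
    have tail: "(2 * real N) ^ (2 * k) \<le> 4 ^ n * W"
    proof -
      have "(2 * real N) ^ (2 * k) = 4 ^ k * (real N ^ (2 * k) * 1)"
        by (simp add: power_mult power_mult_distrib)
      also have "\<dots> \<le> 4 ^ n * (real N ^ (2 * k) * ((real N)\<^sup>2 * \<Delta> * L ^ (k * k)))"
      proof (intro mult_mono)
        have "1 \<le> y\<^sup>2 * (1 / y)"
          using y2 by (simp add: power2_eq_square)
        also have "\<dots> \<le> (real N)\<^sup>2 * \<Delta>"
          using N y2 \<Delta>0 by (intro mult_mono power_mono) simp_all
        also have "\<dots> \<le> (real N)\<^sup>2 * \<Delta> * L ^ (k * k)"
          using \<Delta>0 mult_left_mono[OF one_le_power[OF L1, of "k * k"], of "(real N)\<^sup>2 * \<Delta>"] by simp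
        finally show "1 \<le> (real N)\<^sup>2 * \<Delta> * L ^ (k * k)" .
      qed (simp_all add: n k_def)
      also have "\<dots> = 4 ^ n * W"
        by (simp add: W_def n k_def power2_eq_square mult_ac)
      finally show ?thesis .
    qed
    have "norm (T n \<alpha> x y) ^ (2 ^ n)
      \<le> (2 * real N) ^ (2 ^ n - 2 * n) * (2 * (4 ^ k * ((real N * (1 + ln (real N)) ^ j) ^ k
         * (real N * ((fact n * real N ^ k / real q + 1) * (6 * real N + 2 * real q * (1 + ln (real q))))))
         + (real k)\<^sup>2 * (2 * real N) ^ (2 * k)))"
      unfolding T_eq unfolding n k_def by (rule weyl_inequality_explicit[OF q cop approx len])
    also have "\<dots> \<le> (2 * real N) ^ (2 ^ n - 2 * n) * (2 * (4 ^ k * (c1 * W) + (real k)\<^sup>2 * (4 ^ n * W)))"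
      using weyl_main_term_le[OF q y N, of j] tail
      by (intro mult_left_mono add_mono) (simp_all add: c1_def W_def \<Delta>_def L_def n k_def)
    also have "\<dots> = (2 * real N) ^ (2 ^ n - 2 * n) * (c2 * W)"
      by (simp add: c2_def algebra_simps)
    also have "\<dots> \<le> (2 * real N) ^ (2 ^ n - 2 * n) * (c2 * ((2 * real N) ^ (2 * n) * \<Delta> * L ^ (k * k)))"
      unfolding W_def using c2 \<Delta>0 L1
      by (intro mult_left_mono mult_right_mono power_mono) simp_all
    also have "\<dots> = c2 * (2 * real N) ^ (2 ^ n) * \<Delta> * L ^ (k * k)"
    proof -
      have "(2 * real N) ^ (2 ^ n) = (2 * real N) ^ (2 ^ n - 2 * n) * (2 * real N) ^ (2 * n)"
        using double_le_two_power[OF assms] by (metis le_add_diff_inverse2 power_add)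
      then show ?thesis
        by (simp only: mult_ac)
    qed
    also have "\<dots> \<le> c2 * (4 * y) ^ (2 ^ n) * \<Delta> * L ^ (k * k)"
      using c2 \<Delta>0 L1 N by (intro mult_left_mono mult_right_mono power_mono) simp_all
    also have "\<dots> = c2 * 4 ^ (2 ^ n) * y ^ (2 ^ n) * \<Delta> * L ^ (k * k)"
      by (simp add: power_mult_distrib)
    finally have "norm (T n \<alpha> x y) \<le> (c2 * 4 ^ (2 ^ n)) powr (1 / real (2 ^ n))
        * (y * \<Delta> powr (1 / real (2 ^ n)) * L powr (real (k * k) / real (2 ^ n)))"
      using c2 y2 \<Delta>0 L1 by (intro le_powr_of_power_le) simp_all
    moreover have "real (k * k) = (real n - 1)\<^sup>2"
      by (simp add: n k_def power2_eq_square algebra_simps)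
    ultimately show ?thesis
      by (simp add: C_def \<Delta>_def L_def del: of_nat_mult)
  qed
  moreover have "0 < C"
    using c2 by (simp add: C_def)
  ultimately show ?thesis
    by (intro exI[of _ "exp (exp 1)"] exI[of _ C] conjI allI impI) simp_all
qed

end
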